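(* The sepr-sequences attained by $n\times n$ complex Hermitian matrices for $n=1,2,3$ are exactly the following. For $n=1$ (3 sequences): $\mathtt{A^+}$, $\mathtt{A^-}$, $\mathtt{N}$. For $n=2$ (13 sequences): $\mathtt{A^*A^-}$, $\mathtt{A^+A^+}$, $\mathtt{A^+A^-}$, $\mathtt{A^+N}$, $\mathtt{A^-A^+}$, $\mathtt{A^-A^-}$, $\mathtt{A^-N}$, $\mathtt{NA^-}$, $\mathtt{NN}$, $\mathtt{S^+A^-}$, $\mathtt{S^+N}$, $\mathtt{S^-A^-}$, $\mathtt{S^-N}$. For $n=3$ (65 sequences): $\mathtt{A^*A^*A^+}$, $\mathtt{A^*A^*A^-}$, $\mathtt{A^*A^-A^+}$, $\mathtt{A^*A^-A^-}$, $\mathtt{A^+A^*A^-}$, $\mathtt{A^+A^+A^+}$, $\mathtt{A^+A^+A^-}$, $\mathtt{A^+A^-A^+}$, $\mathtt{A^+A^-A^-}$, $\mathtt{A^-A^*A^+}$, $\mathtt{A^-A^+A^+}$, $\mathtt{A^-A^+A^-}$, $\mathtt{A^-A^-A^+}$, $\mathtt{A^-A^-A^-}$, $\mathtt{A^*A^-N}$, $\mathtt{A^+A^+N}$, $\mathtt{A^+A^-N}$, $\mathtt{A^-A^+N}$, $\mathtt{A^-A^-N}$, $\mathtt{A^+NA^-}$, $\mathtt{A^-NA^+}$, $\mathtt{A^+NN}$, $\mathtt{A^-NN}$, $\mathtt{A^*S^-A^+}$, $\mathtt{A^*S^-A^-}$, $\mathtt{A^+S^*A^-}$, $\mathtt{A^+S^+A^-}$,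 $\mathtt{A^+S^-A^-}$, $\mathtt{A^-S^*A^+}$, $\mathtt{A^-S^+A^+}$, $\mathtt{A^-S^-A^+}$, $\mathtt{A^*S^-N}$, $\mathtt{A^+S^+N}$, $\mathtt{A^+S^-N}$, $\mathtt{A^-S^+N}$, $\mathtt{A^-S^-N}$, $\mathtt{NA^-A^+}$, $\mathtt{NA^-A^-}$, $\mathtt{NA^-N}$, $\mathtt{NNN}$, $\mathtt{NS^-N}$, $\mathtt{S^*A^-A^+}$, $\mathtt{S^*A^-A^-}$, $\mathtt{S^+A^*A^-}$, $\mathtt{S^+A^-A^+}$, $\mathtt{S^+A^-A^-}$, $\mathtt{S^-A^*A^+}$, $\mathtt{S^-A^-A^+}$, $\mathtt{S^-A^-A^-}$, $\mathtt{S^*A^-N}$, $\mathtt{S^+A^-N}$, $\mathtt{S^-A^-N}$, $\mathtt{S^+NN}$, $\mathtt{S^-NN}$, $\mathtt{S^*S^-A^+}$, $\mathtt{S^*S^-A^-}$, $\mathtt{S^+S^*A^-}$, $\mathtt{S^+S^-A^-}$, $\mathtt{S^-S^*A^+}$, $\mathtt{S^-S^-A^+}$, $\mathtt{S^*S^-N}$, $\mathtt{S^+S^+N}$, $\mathtt{S^+S^-N}$, $\mathtt{S^-S^+N}$, $\mathtt{S^-S^-N}$.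
   Context: A principal minor of order $k$ of an $n\times n$ matrix is the determinant of a $k\times k$ principal submatrix (same row and column index set). The signed enhanced principal rank characteristic sequence (sepr-sequence) of an $n\times n$ complex Hermitian matrix $B$ is $\operatorname{sepr}(B)=t_1t_2\cdots t_n$, where: $t_k=\mathtt{A^*}$ if all order-$k$ principal minors are nonzero and there are both a positive and a negative one; $t_k=\mathtt{A^+}$ (resp. $\mathtt{A^-}$) if all order-$k$ principal minors are positive (resp. negative); $t_k=\mathtt{N}$ if all are zero; $t_k=\mathtt{S^*}$ if there are a positive, a negative and a zero order-$k$ principal minor; $t_k=\mathtt{S^+}$ (resp. $\mathtt{S^-}$) if there are both a zero and a nonzero order-$k$ principal minor, and every nonzero one is positive (resp. negative). A sequence of length $n$ is attained by a matrix $B$ if it equals $\operatorname{sepr}(B)$. *)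

theory Defs
  imports "Jordan_Normal_Form.Schur_Decomposition" "Jordan_Normal_Form.DL_Submatrix"
begin

definition hermitian_mat :: "complex mat \<Rightarrow> bool" where
  "hermitian_mat B \<longleftrightarrow> mat_adjoint B = B"

definition principal_minors :: "complex mat \<Rightarrow> nat \<Rightarrow> complex set" where
  "principal_minors B k =
     {det (submatrix B I I) | I. I \<subseteq> {..<dim_row B} \<and> card I = k}"

datatype sepr_symbol = A_star | A_plus | A_minus | N | S_star | S_plus | S_minus

text \<open>
  The order on \<^typ>\<open>complex\<close> is the one of \<^theory>\<open>HOL-Library.Complex_Order\<close>: \<open>0 < z\<close> means that \<open>z\<close> is
  real and positive. All principal minors of a Hermitian matrix are real, so on a nonempty set of
  them exactly one of the seven conditions below holds; \<open>undefined\<close> is reached only for sets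
  that do not arise in this way.
\<close>

definition sepr_symbol_of :: "complex set \<Rightarrow> sepr_symbol" where
  "sepr_symbol_of M =
    (if (\<forall>x\<in>M. x \<noteq> 0) \<and> (\<exists>x\<in>M. 0 < x) \<and> (\<exists>x\<in>M. x < 0) then A_star
     else if \<forall>x\<in>M. 0 < x then A_plus
     else if \<forall>x\<in>M. x < 0 then A_minus
     else if \<forall>x\<in>M. x = 0 then N
     else if (\<exists>x\<in>M. 0 < x) \<and> (\<exists>x\<in>M. x < 0) \<and> 0 \<in> M then S_star
     else if 0 \<in> M \<and> (\<exists>x\<in>M. x \<noteq> 0) \<and> (\<forall>x\<in>M. x \<noteq> 0 \<longrightarrow> 0 < x) then S_plus
     else if 0 \<in> M \<and> (\<exists>x\<in>M. x \<noteq> 0) \<and> (\<forall>x\<in>M. x \<noteq> 0 \<longrightarrow> x < 0) then S_minus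
     else undefined)"

definition sepr :: "complex mat \<Rightarrow> sepr_symbol list" where
  "sepr B = map (\<lambda>k. sepr_symbol_of (principal_minors B k)) [1..<Suc (dim_row B)]"

definition attained_seprs :: "nat \<Rightarrow> sepr_symbol list set" where
  "attained_seprs n = {sepr B | B. B \<in> carrier_mat n n \<and> hermitian_mat B}"

end

theory Submission
  imports Defs
begin

text \<open>
  For a Hermitian matrix with diagonal \<open>a, b, c\<close>, second order principal minors \<open>p, q, r\<close> and determinant
  \<open>d\<close>, one has \<open>p \<le> a b\<close>, and, because complementary off-diagonal minors are conjugate, the
  Desnanot-Jacobi identity gives \<open>a d \<le> p q\<close>; moreover \<open>d = b q\<close> if \<open>a = p = 0\<close>. All these relations, and the
  ones obtained by permuting indices, depend on signs only. Running through the \<open>3\<^sup>7\<close> sign vectors shows that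
  they exclude every sequence that is not listed; the listed ones are attained by small integer
  matrices, and in one case by a Gaussian integer matrix.
\<close>

section \<open>Symbols determined by the signs of a list of numbers\<close>

definition sign_symbol :: "'a::linordered_idom list \<Rightarrow> sepr_symbol" where
  "sign_symbol xs =
    (if 0 \<in> set xs then
       if \<exists>x\<in>set xs. 0 < x then if \<exists>x\<in>set xs. x < 0 then S_star else S_plus
       else if \<exists>x\<in>set xs. x < 0 then S_minus else N
     else if \<exists>x\<in>set xs. 0 < x then if \<exists>x\<in>set xs. x < 0 then A_star else A_plus
       else A_minus)"

text \<open>All seven conditions are Boolean combinations of three facts: whether a zero, a positive
  and a negative number occur. On empty input the two sides differ: \<open>A_plus\<close> on the
  left, \<open>A_minus\<close> on the right.\<close>

lemma sepr_symbol_of_reals: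
  assumes "xs \<noteq> []"
  shows "sepr_symbol_of (complex_of_real ` set xs) = sign_symbol xs"
proof -
  define M where "M = complex_of_real ` set xs"
  define z p n where "z \<longleftrightarrow> 0 \<in> set xs" and "p \<longleftrightarrow> (\<exists>x\<in>set xs. 0 < x)" and "n \<longleftrightarrow> (\<exists>x\<in>set xs. x < 0)"
  have "(\<forall>x\<in>M. x \<noteq> 0) \<longleftrightarrow> \<not> z" "0 \<in> M \<longleftrightarrow> z"
    by (auto simp: M_def z_def)
  moreover have "(\<exists>x\<in>M. 0 < x) \<longleftrightarrow> p" "(\<exists>x\<in>M. x < 0) \<longleftrightarrow> n"
    by (auto simp: M_def p_def n_def less_complex_def)
  moreover have "(\<forall>x\<in>M. 0 < x) \<longleftrightarrow> \<not> z \<and> \<not> n" "(\<forall>x\<in>M. x < 0) \<longleftrightarrow> \<not> z \<and> \<not> p"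
    "(\<forall>x\<in>M. x = 0) \<longleftrightarrow> \<not> p \<and> \<not> n" "(\<exists>x\<in>M. x \<noteq> 0) \<longleftrightarrow> p \<or> n"
    "(\<forall>x\<in>M. x \<noteq> 0 \<longrightarrow> 0 < x) \<longleftrightarrow> \<not> n" "(\<forall>x\<in>M. x \<noteq> 0 \<longrightarrow> x < 0) \<longleftrightarrow> \<not> p"
    unfolding M_def z_def p_def n_def
    by (simp_all add: less_complex_def, (metis less_asym less_irrefl linorder_less_linear)+)
  \<comment> \<open>Nonemptiness enters here and rules out the one Boolean case in which the symbols
    disagree.\<close>
  moreover have "z \<or> p \<or> n"
  proof -
    obtain u where "u \<in> set xs" using assms by (meson last_in_set)
    then show ?thesis using less_linear[of u 0] by (auto simp: z_def p_def n_def)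
  qed
  ultimately have "sepr_symbol_of M =
      (if z then if p then if n then S_star else S_plus else if n then S_minus else N
       else if p then if n then A_star else A_plus else A_minus)"
    unfolding sepr_symbol_of_def by (cases z; cases p; cases n; simp only:; simp)
  then show ?thesis by (simp add: M_def z_def p_def n_def sign_symbol_def)
qed

text \<open>Only signs matter, so real minors may be replaced by integer signs, and integer
  witnesses may be read as reals.\<close>

lemma sign_symbol_map:
  assumes "\<And>x. 0 < f x \<longleftrightarrow> 0 < x" and "\<And>x. f x < 0 \<longleftrightarrow> x < 0"
  shows "sign_symbol (map f xs) = sign_symbol xs"
proof -
  have "0 = f x \<longleftrightarrow> 0 = x" for x
    using assms[of x] by (metis less_irrefl linorder_less_linear)
  then show ?thesis using assms by (simp add: sign_symbol_def image_iff)
qed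

section \<open>Determinants of small matrices and of principal submatrices\<close>

lemma det_2:
  assumes "A \<in> carrier_mat 2 2"
  shows "det A = A $$ (0,0) * A $$ (1,1) - A $$ (0,1) * A $$ (1,0)"
  using assms
  by (subst laplace_expansion_row[OF assms, of 0])
     (auto simp: cofactor_def mat_delete_def det_single numeral_2_eq_2)

lemma det_3:
  assumes "A \<in> carrier_mat 3 3"
  shows "det A =
      A $$ (0,0) * (A $$ (1,1) * A $$ (2,2) - A $$ (1,2) * A $$ (2,1))
    - A $$ (0,1) * (A $$ (1,0) * A $$ (2,2) - A $$ (1,2) * A $$ (2,0))
    + A $$ (0,2) * (A $$ (1,0) * A $$ (2,1) - A $$ (1,1) * A $$ (2,0))"
  using assms
  by (subst laplace_expansion_row[OF assms, of 0])
     (auto simp: cofactor_def mat_delete_def det_2 numeral_3_eq_3 numeral_2_eq_2 algebra_simps)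

text \<open>\<open>submatrix\<close> reindexes by \<open>pick\<close>, which enumerates an index set
  in increasing order.\<close>

lemma pick_pair:
  assumes "i < j"
  shows "pick {i, j} 0 = i" "pick {i, j} (Suc 0) = j"
proof -
  show 0: "pick {i, j} 0 = i" using assms by (auto intro!: Least_equality)
  show "pick {i, j} (Suc 0) = j"
    using assms unfolding pick.simps(2) 0 by (auto intro!: Least_equality)
qed

lemma det_submatrix_singleton:
  assumes "A \<in> carrier_mat n n" "i < n"
  shows "det (submatrix A {i} {i}) = A $$ (i, i)"
proof -
  \<comment> \<open>The dimension of a \<open>submatrix\<close> is the cardinality of such a
    set.\<close>
  have [simp]: "{k. k < n \<and> k = i} = {i}" using assms by auto
  have "pick {i} 0 = i" by (auto intro!: Least_equality)
  then show ?thesis using assms by (subst det_single) (auto simp: submatrix_def)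
qed

lemma det_submatrix_pair:
  assumes "A \<in> carrier_mat n n" "i < j" "j < n"
  shows "det (submatrix A {i, j} {i, j}) = A $$ (i,i) * A $$ (j,j) - A $$ (i,j) * A $$ (j,i)"
proof -
  have [simp]: "{k. k < n \<and> (k = i \<or> k = j)} = {i, j}" using assms by auto
  have "submatrix A {i, j} {i, j} \<in> carrier_mat 2 2"
    using assms by (auto simp: submatrix_def)
  from det_2[OF this] show ?thesis
    using assms pick_pair[OF assms(2)] by (simp add: submatrix_def del: pick.simps)
qed

lemma submatrix_full:
  assumes "A \<in> carrier_mat n n"
  shows "submatrix A {..<n} {..<n} = A"
proof -
  \<comment> \<open>Below \<open>n\<close>, the initial segment is enumerated exactly like
    \<open>UNIV\<close>.\<close>
  have "pick {..<n} i = i" if "i < n" for i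
    using pick_reduce_set[of i n UNIV] that by (simp add: pick_UNIV lessThan_def)
  then show ?thesis using assms by (intro eq_matI) (auto simp: submatrix_def simp flip: lessThan_def)
qed

section \<open>Parametrization of Hermitian matrices by diagonal and upper triangle\<close>

lemma hermitian_mat_iff:
  assumes "B \<in> carrier_mat n n"
  shows "hermitian_mat B \<longleftrightarrow> (\<forall>i<n. \<forall>j<n. cnj (B $$ (j,i)) = B $$ (i,j))"
proof -
  have "mat_adjoint B $$ (i,j) = cnj (B $$ (j,i))" if "i < n" "j < n" for i j
    using that assms by (simp add: mat_adjoint_def mat_of_rows_def)
  moreover have "dim_row (mat_adjoint B) = n" "dim_col (mat_adjoint B) = n"
    using assms by (auto simp: mat_adjoint_def)
  ultimately show ?thesis
    unfolding hermitian_mat_def using assms by (simp add: mat_eq_iff)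
qed

text \<open>As an image over a filtered power set, the minors can be listed once the index sets of
  size \<open>k\<close> are enumerated.\<close>

lemma principal_minors_image:
  "principal_minors B k = (\<lambda>I. det (submatrix B I I)) ` {I \<in> Pow {..<dim_row B}. card I = k}"
  by (auto simp: principal_minors_def)

definition herm1 :: "real \<Rightarrow> complex mat" where
  "herm1 a = mat 1 1 (\<lambda>(i, j). [[of_real a]] ! i ! j)"

definition herm2 :: "real \<Rightarrow> real \<Rightarrow> complex \<Rightarrow> complex mat" where
  "herm2 a b x = mat 2 2 (\<lambda>(i, j). [[of_real a, x], [cnj x, of_real b]] ! i ! j)"

definition herm3 :: "real \<Rightarrow> real \<Rightarrow> real \<Rightarrow> complex \<Rightarrow> complex \<Rightarrow> complex \<Rightarrow> complex mat" where
  "herm3 a b c x y z = mat 3 3 (\<lambda>(i, j).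
     [[of_real a, x, y], [cnj x, of_real b, z], [cnj y, cnj z, of_real c]] ! i ! j)"

lemma all_less_2: "(\<forall>i<2. P i) \<longleftrightarrow> P 0 \<and> P (1::nat)"
  by (auto simp: less_2_cases_iff)

lemma all_less_3: "(\<forall>i<3. P i) \<longleftrightarrow> P 0 \<and> P 1 \<and> P (2::nat)"
  by (auto simp: numeral_3_eq_3 less_Suc_eq numeral_2_eq_2)

lemma cnj_eq_self: "cnj w = w \<Longrightarrow> complex_of_real (Re w) = w"
  by (simp add: complex_eq_iff)

lemma hermitian_1_iff:
  "B \<in> carrier_mat 1 1 \<and> hermitian_mat B \<longleftrightarrow> (\<exists>a. B = herm1 a)" (is "?L \<longleftrightarrow> ?R")
proof
  assume L: ?L
  then have *: "cnj (B $$ (0,0)) = B $$ (0,0)" using hermitian_mat_iff by blast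
  then have "B = herm1 (Re (B $$ (0,0)))"
    using L cnj_eq_self[OF *] by (auto simp: herm1_def mat_eq_iff)
  then show ?R by blast
next
  assume ?R
  then show ?L
    using hermitian_mat_iff[of B 1] by (auto simp: herm1_def)
qed

lemma hermitian_2_iff:
  "B \<in> carrier_mat 2 2 \<and> hermitian_mat B \<longleftrightarrow> (\<exists>a b x. B = herm2 a b x)" (is "?L \<longleftrightarrow> ?R")
proof
  assume L: ?L
  then have *: "cnj (B $$ (j,i)) = B $$ (i,j)" if "i < 2" "j < 2" for i j
    using hermitian_mat_iff that by blast
  have "B = herm2 (Re (B $$ (0,0))) (Re (B $$ (1,1))) (B $$ (0,1))"
    using L *[of 1 0] cnj_eq_self[OF *[of 0 0]] cnj_eq_self[OF *[of 1 1]]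
    by (auto simp: herm2_def mat_eq_iff all_less_2)
  then show ?R by blast
next
  assume ?R
  then show ?L
    using hermitian_mat_iff[of B 2] by (auto simp: herm2_def all_less_2)
qed

lemma hermitian_3_iff:
  "B \<in> carrier_mat 3 3 \<and> hermitian_mat B \<longleftrightarrow> (\<exists>a b c x y z. B = herm3 a b c x y z)" (is "?L \<longleftrightarrow> ?R")
proof
  assume L: ?L
  then have *: "cnj (B $$ (j,i)) = B $$ (i,j)" if "i < 3" "j < 3" for i j
    using hermitian_mat_iff that by blast
  have "B = herm3 (Re (B $$ (0,0))) (Re (B $$ (1,1))) (Re (B $$ (2,2)))
      (B $$ (0,1)) (B $$ (0,2)) (B $$ (1,2))"
    using L *[of 1 0] *[of 2 0] *[of 2 1]
      cnj_eq_self[OF *[of 0 0]] cnj_eq_self[OF *[of 1 1]] cnj_eq_self[OF *[of 2 2]]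
    by (auto simp: herm3_def mat_eq_iff all_less_3)
  then show ?R by blast
next
  assume ?R
  then show ?L
    using hermitian_mat_iff[of B 3] by (auto simp: herm3_def all_less_3)
qed

section \<open>The sequences in terms of the matrix entries\<close>

lemma sepr_herm1: "sepr (herm1 a) = [sign_symbol [a]]"
proof -
  have A: "herm1 a \<in> carrier_mat 1 1" by (simp add: herm1_def)
  then have D: "dim_row (herm1 a) = 1" by simp
  have *: "{I \<in> Pow {..<1}. card I = 1} = {{0::nat}}"
    by (auto simp: lessThan_Suc Pow_insert)
  have "principal_minors (herm1 a) 1 = complex_of_real ` set [a]"
    unfolding principal_minors_image D *
    by (simp add: det_submatrix_singleton[OF A]) (simp add: herm1_def)
  then show ?thesis using A sepr_symbol_of_reals[of "[a]"] by (simp add: sepr_def)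
qed

lemma sepr_herm2:
  "sepr (herm2 a b x) = [sign_symbol [a, b], sign_symbol [a * b - (cmod x)\<^sup>2]]"
proof -
  have A: "herm2 a b x \<in> carrier_mat 2 2" by (simp add: herm2_def)
  then have D: "dim_row (herm2 a b x) = 2" by simp
  have *: "{I \<in> Pow {..<2}. card I = 1} = {{0::nat}, {1}}"
    "{I \<in> Pow {..<2}. card I = 2} = {{0::nat, 1}}"
    by (auto simp: lessThan_Suc Pow_insert numeral_2_eq_2)
  have 1: "principal_minors (herm2 a b x) 1 = complex_of_real ` set [a, b]"
    unfolding principal_minors_image D *
    by (simp add: det_submatrix_singleton[OF A]) (simp add: herm2_def)
  have 2: "principal_minors (herm2 a b x) 2 = complex_of_real ` set [a * b - (cmod x)\<^sup>2]"
    unfolding principal_minors_image D *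
    by (simp add: det_submatrix_pair[OF A])
       (simp add: herm2_def flip: complex_norm_square)
  have "[1..<Suc 2] = [1, 2]" by (simp add: upt_rec)
  then show ?thesis
    using A 1 2 by (simp add: sepr_def sepr_symbol_of_reals del: set_simps upt_Suc)
qed

lemma sepr_herm3:
  "sepr (herm3 a b c x y z) =
    [sign_symbol [a, b, c],
     sign_symbol [a * b - (cmod x)\<^sup>2, a * c - (cmod y)\<^sup>2, b * c - (cmod z)\<^sup>2],
     sign_symbol [a * b * c + 2 * Re (x * z * cnj y)
       - a * (cmod z)\<^sup>2 - b * (cmod y)\<^sup>2 - c * (cmod x)\<^sup>2]]"
proof -
  have A: "herm3 a b c x y z \<in> carrier_mat 3 3" by (simp add: herm3_def)
  then have D: "dim_row (herm3 a b c x y z) = 3" by simp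
  have *: "{I \<in> Pow {..<3}. card I = 1} = {{0::nat}, {1}, {2}}"
    "{I \<in> Pow {..<3}. card I = 2} = {{0::nat, 1}, {0, 2}, {1, 2}}"
    "{I \<in> Pow {..<3}. card I = 3} = {{..<3::nat}}"
    by (auto simp: lessThan_Suc Pow_insert numeral_2_eq_2 numeral_3_eq_3)
  have 1: "principal_minors (herm3 a b c x y z) 1 = complex_of_real ` set [a, b, c]"
    unfolding principal_minors_image D *
    by (simp add: det_submatrix_singleton[OF A]) (simp add: herm3_def)
  have 2: "principal_minors (herm3 a b c x y z) 2 = complex_of_real `
      set [a * b - (cmod x)\<^sup>2, a * c - (cmod y)\<^sup>2, b * c - (cmod z)\<^sup>2]"
    unfolding principal_minors_image D *
    by (simp add: det_submatrix_pair[OF A])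
       (simp add: herm3_def flip: complex_norm_square)
  have 3: "principal_minors (herm3 a b c x y z) 3 = complex_of_real `
      set [a * b * c + 2 * Re (x * z * cnj y)
        - a * (cmod z)\<^sup>2 - b * (cmod y)\<^sup>2 - c * (cmod x)\<^sup>2]"
    unfolding principal_minors_image D *
    \<comment> \<open>The two cyclic products in the expansion are conjugate and add up to
      \<open>2 * Re (x * z * cnj y)\<close>; comparing real and imaginary parts confirms the
      formula.\<close>
    by (simp add: submatrix_full[OF A] det_3[OF A])
       (simp add: herm3_def complex_eq_iff cmod_power2, simp add: power2_eq_square algebra_simps)
  have "[1..<Suc 3] = [1, 2, 3]" by (simp add: upt_rec)
  then show ?thesis
    using A 1 2 3 by (simp add: sepr_def sepr_symbol_of_reals del: set_simps upt_Suc)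
qed

section \<open>Sign vectors and the exclusion of unlisted sequences\<close>

definition int_sgn :: "real \<Rightarrow> int" where
  "int_sgn x = (if 0 < x then 1 else if x < 0 then -1 else 0)"

lemma int_sgn_eq_0_iff: "int_sgn x = 0 \<longleftrightarrow> x = 0"
  by (simp add: int_sgn_def)

lemma int_sgn_in: "int_sgn x \<in> set [-1, 0, 1]"
  by (simp add: int_sgn_def)

text \<open>With multiplicativity, this carries inequalities such as \<open>p \<le> a * b\<close>
  over to signs, where finitely many cases can be evaluated.\<close>

lemma int_sgn_mono: "x \<le> y \<Longrightarrow> int_sgn x \<le> int_sgn y"
  by (simp add: int_sgn_def)

lemma int_sgn_mult: "int_sgn (x * y) = int_sgn x * int_sgn y"
  by (auto simp: int_sgn_def zero_less_mult_iff mult_less_0_iff)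

lemma sign_symbol_int_sgn: "sign_symbol (map int_sgn xs) = sign_symbol xs"
  by (rule sign_symbol_map) (simp_all add: int_sgn_def)

lemma sign_symbol_of_int: "sign_symbol (map real_of_int ks) = sign_symbol ks"
  by (rule sign_symbol_map) simp_all

definition table2 :: "sepr_symbol list list" where
  "table2 =
    [[A_star, A_minus], [A_plus, A_plus], [A_plus, A_minus], [A_plus, N],
     [A_minus, A_plus], [A_minus, A_minus], [A_minus, N], [N, A_minus],
     [N, N], [S_plus, A_minus], [S_plus, N], [S_minus, A_minus],
     [S_minus, N]]"

definition table3 :: "sepr_symbol list list" where
  "table3 =
    [[A_star, A_star, A_plus], [A_star, A_star, A_minus], [A_star, A_minus, A_plus],
     [A_star, A_minus, A_minus], [A_plus, A_star, A_minus], [A_plus, A_plus, A_plus],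
     [A_plus, A_plus, A_minus], [A_plus, A_minus, A_plus], [A_plus, A_minus, A_minus],
     [A_minus, A_star, A_plus], [A_minus, A_plus, A_plus], [A_minus, A_plus, A_minus],
     [A_minus, A_minus, A_plus], [A_minus, A_minus, A_minus], [A_star, A_minus, N],
     [A_plus, A_plus, N], [A_plus, A_minus, N], [A_minus, A_plus, N],
     [A_minus, A_minus, N], [A_plus, N, A_minus], [A_minus, N, A_plus],
     [A_plus, N, N], [A_minus, N, N], [A_star, S_minus, A_plus],
     [A_star, S_minus, A_minus], [A_plus, S_star, A_minus], [A_plus, S_plus, A_minus],
     [A_plus, S_minus, A_minus], [A_minus, S_star, A_plus], [A_minus, S_plus, A_plus],
     [A_minus, S_minus, A_plus], [A_star, S_minus, N], [A_plus, S_plus, N],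
     [A_plus, S_minus, N], [A_minus, S_plus, N], [A_minus, S_minus, N],
     [N, A_minus, A_plus], [N, A_minus, A_minus], [N, A_minus, N],
     [N, N, N], [N, S_minus, N], [S_star, A_minus, A_plus],
     [S_star, A_minus, A_minus], [S_plus, A_star, A_minus], [S_plus, A_minus, A_plus],
     [S_plus, A_minus, A_minus], [S_minus, A_star, A_plus], [S_minus, A_minus, A_plus],
     [S_minus, A_minus, A_minus], [S_star, A_minus, N], [S_plus, A_minus, N],
     [S_minus, A_minus, N], [S_plus, N, N], [S_minus, N, N],
     [S_star, S_minus, A_plus], [S_star, S_minus, A_minus], [S_plus, S_star, A_minus],
     [S_plus, S_minus, A_minus], [S_minus, S_star, A_plus], [S_minus, S_minus, A_plus],
     [S_star, S_minus, N], [S_plus, S_plus, N], [S_plus, S_minus, N],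
     [S_minus, S_plus, N], [S_minus, S_minus, N]]"

text \<open>The bound on \<open>p\<close> reflects that the minor is \<open>a * b\<close> minus a
  squared modulus; evaluation of the 27 sign vectors does the rest.\<close>

lemma table2_complete:
  "\<forall>a\<in>set [-1,0,1]. \<forall>b\<in>set [-1,0,1]. \<forall>p\<in>set [-1,0,1]. p \<le> a * b \<longrightarrow>
     [sign_symbol [a, b], sign_symbol [p::int]] \<in> set table2"
  by code_simp

text \<open>
  The hypotheses are what is known about the signs of the principal minors: \<open>a, b, c\<close> of order one,
  \<open>p, q, r\<close> of order two (rows 12, 13, 23) and \<open>d\<close> the determinant. The bounds on
  \<open>p, q, r\<close> come from \<open>p = a b - |x|\<^sup>2\<close>, the next three from the Desnanot-Jacobi identity, and the last six
  from the fact that \<open>a = p = 0\<close> forces \<open>x = 0\<close>.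
\<close>

lemma table3_complete:
  "\<forall>a\<in>set [-1,0,1]. \<forall>b\<in>set [-1,0,1]. \<forall>c\<in>set [-1,0,1].
   \<forall>p\<in>set [-1,0,1]. p \<le> a * b \<longrightarrow>
   (\<forall>q\<in>set [-1,0,1]. q \<le> a * c \<longrightarrow>
   (\<forall>r\<in>set [-1,0,1]. r \<le> b * c \<longrightarrow>
   (\<forall>d\<in>set [-1,0,1]. a * d \<le> p * q \<longrightarrow> b * d \<le> p * r \<longrightarrow> c * d \<le> q * r \<longrightarrow>
     (a = 0 \<longrightarrow> p = 0 \<longrightarrow> d = b * q) \<longrightarrow> (a = 0 \<longrightarrow> q = 0 \<longrightarrow> d = c * p) \<longrightarrow>
     (b = 0 \<longrightarrow> p = 0 \<longrightarrow> d = a * r) \<longrightarrow> (b = 0 \<longrightarrow> r = 0 \<longrightarrow> d = c * p) \<longrightarrow>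
     (c = 0 \<longrightarrow> q = 0 \<longrightarrow> d = a * r) \<longrightarrow> (c = 0 \<longrightarrow> r = 0 \<longrightarrow> d = b * q) \<longrightarrow>
     [sign_symbol [a, b, c], sign_symbol [p, q, r], sign_symbol [d::int]] \<in> set table3)))"
  by code_simp

lemma sepr_herm2_in_table: "sepr (herm2 a b x) \<in> set table2"
proof -
  define p where "p = a * b - (cmod x)\<^sup>2"
  have "p \<le> a * b" by (simp add: p_def)
  then have "int_sgn p \<le> int_sgn a * int_sgn b" by (metis int_sgn_mono int_sgn_mult)
  then have "[sign_symbol [int_sgn a, int_sgn b], sign_symbol [int_sgn p]] \<in> set table2"
    using table2_complete int_sgn_in by blast
  then show ?thesis
    using sign_symbol_int_sgn[of "[a, b]"] sign_symbol_int_sgn[of "[p]"]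
    by (simp add: sepr_herm2 p_def)
qed

text \<open>The number \<open>a * z - cnj x * y\<close> is the minor on rows 1, 2 and columns 1, 3.
  The transposed minor is its conjugate, so their product is a squared modulus.\<close>

lemma desnanot_jacobi_herm3:
  fixes a b c :: real and x y z :: complex
  defines "p \<equiv> a * b - (cmod x)\<^sup>2" and "q \<equiv> a * c - (cmod y)\<^sup>2"
    and "d \<equiv> a * b * c + 2 * Re (x * z * cnj y)
      - a * (cmod z)\<^sup>2 - b * (cmod y)\<^sup>2 - c * (cmod x)\<^sup>2"
  shows "a * d = p * q - (cmod (a * z - cnj x * y))\<^sup>2"
  unfolding p_def q_def d_def cmod_power2
  by (simp add: power2_eq_square algebra_simps)

lemma sepr_herm3_in_table: "sepr (herm3 a b c x y z) \<in> set table3"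
proof -
  define p q r d where "p = a * b - (cmod x)\<^sup>2" and "q = a * c - (cmod y)\<^sup>2"
    and "r = b * c - (cmod z)\<^sup>2"
    and "d = a * b * c + 2 * Re (x * z * cnj y)
      - a * (cmod z)\<^sup>2 - b * (cmod y)\<^sup>2 - c * (cmod x)\<^sup>2"
  note defs = p_def q_def r_def d_def
  have le: "p \<le> a * b" "q \<le> a * c" "r \<le> b * c"
    by (simp_all add: defs)
  have "a * d = p * q - (cmod (a * z - cnj x * y))\<^sup>2"
    unfolding defs by (rule desnanot_jacobi_herm3)
  moreover have "b * d = p * r - (cmod (b * y - x * z))\<^sup>2"
    \<comment> \<open>Exchanging the first two indices conjugates \<open>x\<close> and swaps
      \<open>y\<close> with \<open>z\<close>.\<close>
    using desnanot_jacobi_herm3[where a = b and b = a and x = "cnj x" and y = z and z = y] by (simp add: defs algebra_simps)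
  moreover have "c * d = q * r - (cmod (c * x - y * cnj z))\<^sup>2"
    \<comment> \<open>Here the indices are taken in the order 3, 1, 2.\<close>
    using desnanot_jacobi_herm3[where a = c and b = a and c = b and x = "cnj y" and y = "cnj z" and z = x] by (simp add: defs algebra_simps)
  ultimately have minor: "a * d \<le> p * q" "b * d \<le> p * r" "c * d \<le> q * r"
    by simp_all
  \<comment> \<open>In the first case \<open>x = 0\<close>, which leaves
    \<open>d = - b * (cmod y)\<^sup>2\<close> and \<open>q = - (cmod y)\<^sup>2\<close>; the others
    are analogous.\<close>
  have zero: "a = 0 \<Longrightarrow> p = 0 \<Longrightarrow> d = b * q" "a = 0 \<Longrightarrow> q = 0 \<Longrightarrow> d = c * p"
    "b = 0 \<Longrightarrow> p = 0 \<Longrightarrow> d = a * r" "b = 0 \<Longrightarrow> r = 0 \<Longrightarrow> d = c * p"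
    "c = 0 \<Longrightarrow> q = 0 \<Longrightarrow> d = a * r" "c = 0 \<Longrightarrow> r = 0 \<Longrightarrow> d = b * q"
    by (simp_all add: defs)
  have "[sign_symbol [int_sgn a, int_sgn b, int_sgn c],
      sign_symbol [int_sgn p, int_sgn q, int_sgn r], sign_symbol [int_sgn d]] \<in> set table3"
    using le[THEN int_sgn_mono] minor[THEN int_sgn_mono] zero
    by (intro table3_complete[rule_format] int_sgn_in)
       \<comment> \<open>Products of signs are folded into signs of products, the form in which the
         monotonicity facts are stated.\<close>
       (simp_all add: int_sgn_mult int_sgn_eq_0_iff flip: int_sgn_mult)
  then show ?thesis
    using sign_symbol_int_sgn[of "[a, b, c]"] sign_symbol_int_sgn[of "[p, q, r]"]
      sign_symbol_int_sgn[of "[d]"]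
    by (simp add: sepr_herm3 defs)
qed

section \<open>Integer witnesses for the listed sequences\<close>

definition witnesses2 :: "(int \<times> int \<times> int) list" where
  "witnesses2 =
    [(1, -1, 0), (1, 1, 0), (1, 1, 2), (1, 1, 1), (-1, -1, 0),
     (-1, -1, 2), (-1, -1, 1), (0, 0, 1), (0, 0, 0), (1, 0, 1),
     (1, 0, 0), (0, -1, 1), (0, -1, 0)]"

text \<open>
  A tuple \<open>(a, b, c, x, y, v, z)\<close> stands for \<open>herm3 a b c x (y + \<i> v) z\<close>. The only non-real witness is the one
  for \<open>N A\<^sup>- N\<close>: with zero diagonal the determinant is \<open>2 Re (x z cnj y)\<close>, which no real matrix with
  nonzero off-diagonal entries annihilates.
\<close>

definition witnesses3 :: "(int \<times> int \<times> int \<times> int \<times> int \<times> int \<times> int) list" where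
  "witnesses3 =
    [(1, -1, -1, 0, 0, 0, 0), (1, 1, -1, 0, 0, 0, 0), (1, 1, -1, 2, 0, 0, 0), (1, -1, -1, 0, 0, 0, 2),
     (1, 1, 1, 2, 0, 0, 0), (1, 1, 1, 0, 0, 0, 0), (2, 2, 1, 1, 1, 0, -1), (1, 1, 1, 2, 2, 0, 2),
     (1, 1, 1, 2, 2, 0, -2), (-1, -1, -1, 2, 0, 0, 0), (-1, -2, -2, 1, 1, 0, 1), (-1, -1, -1, 0, 0, 0, 0),
     (-1, -1, -1, 2, 2, 0, 2), (-1, -1, -1, 2, 2, 0, -2), (2, 1, -1, 2, 0, 0, 1), (2, 1, 1, 1, 1, 0, 0),
     (2, 1, 1, 2, 2, 0, 3), (-1, -1, -2, 0, 1, 0, 1), (-1, -1, -2, 3, 2, 0, -2), (1, 1, 1, 1, 1, 0, -1),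
     (-1, -1, -1, 1, 1, 0, 1), (1, 1, 1, 1, 1, 0, 1), (-1, -1, -1, 1, 1, 0, -1), (1, -1, -1, 1, 0, 0, 1),
     (1, 1, -1, 1, 1, 0, 0), (1, 1, 1, 2, 1, 0, 0), (1, 1, 1, 1, 1, 0, 0), (1, 1, 1, 2, 1, 0, 1),
     (-1, -1, -1, 2, 1, 0, 0), (-1, -1, -1, 1, 1, 0, 0), (-1, -1, -1, 2, 1, 0, 1), (1, 1, -1, 1, 0, 0, 0),
     (1, 1, 1, 1, 0, 0, 0), (1, 1, 1, 2, 2, 0, 1), (-1, -1, -1, 1, 0, 0, 0), (-1, -1, -1, 2, 2, 0, -1),
     (0, 0, 0, 1, 1, 0, 1), (0, 0, 0, 1, 1, 0, -1), (0, 0, 0, 1, 0, 1, 1), (0, 0, 0, 0, 0, 0, 0),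
     (0, 0, 0, 1, 0, 0, 0), (1, 0, -1, 2, 0, 0, 1), (2, 0, -1, 1, 0, 0, 1), (1, 1, 0, 0, 1, 0, 1),
     (1, 0, 0, 1, 1, 0, 1), (1, 0, 0, 1, 1, 0, -1), (0, -1, -1, 1, 1, 0, 0), (0, 0, -1, 1, 1, 0, 1),
     (0, 0, -1, 1, 1, 0, -1), (1, 0, -1, 1, 0, 0, 1), (2, 0, 0, 1, 1, 0, 1), (0, 0, -1, 2, 1, 0, -1),
     (1, 0, 0, 0, 0, 0, 0), (0, 0, -1, 0, 0, 0, 0), (1, 0, -1, 1, 0, 0, 0), (1, 0, -1, 0, 0, 0, 1),
     (1, 1, 0, 0, 1, 0, 0), (1, 0, 0, 0, 0, 0, 1), (0, -1, -1, 1, 0, 0, 0), (0, 0, -1, 1, 0, 0, 0),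
     (1, 0, -1, 0, 0, 0, 0), (1, 1, 0, 0, 0, 0, 0), (1, 0, 0, 1, 0, 0, 0), (0, -1, -1, 0, 0, 0, 0),
     (0, 0, -1, 0, 1, 0, 0)]"

text \<open>A triple stands for the real matrix \<open>herm2 a b x\<close>, where the squared
  modulus is \<open>x * x\<close>. Witnesses and table share one order, so a single list equation
  checks them all.\<close>

lemma witnesses2_table2:
  "map (\<lambda>(a, b, x). [sign_symbol [a, b], sign_symbol [a * b - x * x]]) witnesses2 = table2"
  by code_simp

text \<open>Since \<open>x\<close> and \<open>z\<close> are real, the squared modulus of
  \<open>Complex y v\<close> is \<open>y * y + v * v\<close>, and \<open>v\<close> drops out of the
  real part in the determinant.\<close>

lemma witnesses3_table3:
  "map (\<lambda>(a, b, c, x, y, v, z).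
      [sign_symbol [a, b, c],
       sign_symbol [a * b - x * x, a * c - (y * y + v * v), b * c - z * z],
       sign_symbol [a * b * c + 2 * (x * z * y) - a * (z * z) - b * (y * y + v * v) - c * (x * x)]])
    witnesses3 = table3"
  by code_simp

lemma table2_attained:
  assumes "t \<in> set table2"
  shows "\<exists>a b x. sepr (herm2 a b x) = t"
proof -
  obtain a b x :: int where t: "t = [sign_symbol [a, b], sign_symbol [a * b - x * x]]"
    \<comment> \<open>Reading the table as the image of the witness list yields the integer
      entries.\<close>
    using assms unfolding witnesses2_table2[symmetric] by auto
  have "sepr (herm2 (of_int a) (of_int b) (of_int x)) = t"
    unfolding t sepr_herm2
    using sign_symbol_of_int[of "[a, b]"] sign_symbol_of_int[of "[a * b - x * x]"]
    by (simp add: power2_eq_square)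
  then show ?thesis by blast
qed

lemma table3_attained:
  assumes "t \<in> set table3"
  shows "\<exists>a b c x y z. sepr (herm3 a b c x y z) = t"
proof -
  obtain a b c x y v z :: int where t: "t =
      [sign_symbol [a, b, c],
       sign_symbol [a * b - x * x, a * c - (y * y + v * v), b * c - z * z],
       sign_symbol [a * b * c + 2 * (x * z * y) - a * (z * z) - b * (y * y + v * v) - c * (x * x)]]"
    using assms unfolding witnesses3_table3[symmetric] by auto
  have "sepr (herm3 (of_int a) (of_int b) (of_int c)
      (of_int x) (Complex (of_int y) (of_int v)) (of_int z)) = t"
    unfolding t sepr_herm3 cmod_power2
    using sign_symbol_of_int[of "[a, b, c]"]
      sign_symbol_of_int[of "[a * b - x * x, a * c - (y * y + v * v), b * c - z * z]"]
      sign_symbol_of_int[of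
        "[a * b * c + 2 * (x * z * y) - a * (z * z) - b * (y * y + v * v) - c * (x * x)]"]
    by (simp add: power2_eq_square)
  then show ?thesis by blast
qed

section \<open>The attained sets and their cardinalities\<close>

lemma attained_seprs_1: "attained_seprs 1 = {[A_plus], [A_minus], [N]}"
proof -
  have "attained_seprs 1 = range (\<lambda>a. sepr (herm1 a))"
    unfolding attained_seprs_def hermitian_1_iff by auto
  moreover have "sign_symbol [1::real] = A_plus" "sign_symbol [-1::real] = A_minus"
    "sign_symbol [0::real] = N" "sign_symbol [a::real] \<in> {A_plus, A_minus, N}" for a
    by (auto simp: sign_symbol_def)
  ultimately show ?thesis by (auto simp: sepr_herm1 image_iff) metis+
qed

lemma attained_seprs_2: "attained_seprs 2 = set table2"
  unfolding attained_seprs_def hermitian_2_iff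
  using sepr_herm2_in_table table2_attained by fastforce

lemma attained_seprs_3: "attained_seprs 3 = set table3"
  unfolding attained_seprs_def hermitian_3_iff
  using sepr_herm3_in_table table3_attained by fastforce

text \<open>Distinctness turns the cardinalities into list lengths.\<close>

lemma distinct_tables: "distinct table2" "distinct table3"
  by code_simp+

theorem mainTheorem3:
  shows "attained_seprs 1 =
    {[A_plus], [A_minus], [N]} \<and>
    card (attained_seprs 1) = 3 \<and>
    attained_seprs 2 =
    {[A_star, A_minus], [A_plus, A_plus], [A_plus, A_minus],
     [A_plus, N], [A_minus, A_plus], [A_minus, A_minus],
     [A_minus, N], [N, A_minus], [N, N],
     [S_plus, A_minus], [S_plus, N], [S_minus, A_minus],
     [S_minus, N]} \<and>
    card (attained_seprs 2) = 13 \<and>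
    attained_seprs 3 =
    {[A_star, A_star, A_plus], [A_star, A_star, A_minus], [A_star, A_minus, A_plus],
     [A_star, A_minus, A_minus], [A_plus, A_star, A_minus], [A_plus, A_plus, A_plus],
     [A_plus, A_plus, A_minus], [A_plus, A_minus, A_plus], [A_plus, A_minus, A_minus],
     [A_minus, A_star, A_plus], [A_minus, A_plus, A_plus], [A_minus, A_plus, A_minus],
     [A_minus, A_minus, A_plus], [A_minus, A_minus, A_minus],
     [A_star, A_minus, N], [A_plus, A_plus, N], [A_plus, A_minus, N],
     [A_minus, A_plus, N], [A_minus, A_minus, N],
     [A_plus, N, A_minus], [A_minus, N, A_plus], [A_plus, N, N],
     [A_minus, N, N],
     [A_star, S_minus, A_plus], [A_star, S_minus, A_minus], [A_plus, S_star, A_minus],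
     [A_plus, S_plus, A_minus], [A_plus, S_minus, A_minus], [A_minus, S_star, A_plus],
     [A_minus, S_plus, A_plus], [A_minus, S_minus, A_plus],
     [A_star, S_minus, N], [A_plus, S_plus, N], [A_plus, S_minus, N],
     [A_minus, S_plus, N], [A_minus, S_minus, N],
     [N, A_minus, A_plus], [N, A_minus, A_minus], [N, A_minus, N],
     [N, N, N], [N, S_minus, N],
     [S_star, A_minus, A_plus], [S_star, A_minus, A_minus], [S_plus, A_star, A_minus],
     [S_plus, A_minus, A_plus], [S_plus, A_minus, A_minus], [S_minus, A_star, A_plus],
     [S_minus, A_minus, A_plus], [S_minus, A_minus, A_minus],
     [S_star, A_minus, N], [S_plus, A_minus, N], [S_minus, A_minus, N],
     [S_plus, N, N], [S_minus, N, N],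
     [S_star, S_minus, A_plus], [S_star, S_minus, A_minus], [S_plus, S_star, A_minus],
     [S_plus, S_minus, A_minus], [S_minus, S_star, A_plus], [S_minus, S_minus, A_plus],
     [S_star, S_minus, N], [S_plus, S_plus, N], [S_plus, S_minus, N],
     [S_minus, S_plus, N], [S_minus, S_minus, N]} \<and>
    card (attained_seprs 3) = 65"
proof (intro conjI)
  show "card (attained_seprs 1) = 3"
    unfolding attained_seprs_1 by simp
  show "card (attained_seprs 2) = 13"
    unfolding attained_seprs_2 distinct_card[OF distinct_tables(1)] by (simp add: table2_def)
  show "card (attained_seprs 3) = 65"
    unfolding attained_seprs_3 distinct_card[OF distinct_tables(2)] by (simp add: table3_def)
\<comment> \<open>The three set equations remain; \<open>list.set\<close> expands each table into
  its explicit set.\<close>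
qed (simp_all only: attained_seprs_1 attained_seprs_2 attained_seprs_3 table2_def table3_def list.set)

end
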